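(* Let $(V,E)$ be a connected finite graph with symmetric positive edge weights $\omega_{xy}=\omega_{yx}>0$ and measure $\mu:V\to(0,\infty)$. Let $G,H:[0,\infty)\to(0,\infty)$ be increasing $C^\infty$ functions, and define $g,h:[0,\infty)\to\mathbb{R}$ by $g(s^2)=\int_s^1 2tG(t^2)\,dt$ and $h(s^2)=\int_s^1 2tH(t^2)\,dt$ for $s\ge 0$. Let $N_1,N_2$ be positive integers and let $p_1',\dots,p_{N_1}'$ and $p_1'',\dots,p_{N_2}''$ be vertices in $V$. For a constant $\lambda>0$ consider the system, for unknown functions $u,v:V\to\mathbb{R}$, $$ (S_\lambda)\qquad \begin{cases} \Delta u=-\lambda e^{v}H(e^{v})\,g(e^{u})+4\pi\sum_{j=1}^{N_1}\delta_{p_j'},\\[2pt] \Delta v=-\lambda e^{u}G(e^{u})\,h(e^{v})+4\pi\sum_{j=1}^{N_2}\delta_{p_j''} \end{cases} \qquad\text{on } V. $$ Then there exists $\lambda_c\ge \dfrac{4\pi\max\{N_1,N_2\}}{G(1)H(1)|V|}$ such that: (i) If $\lambda>\lambda_c$, then $(S_\lambda)$ admits a unique maximal solution $(u_\lambda,v_\lambda)$, in the sense that if $(u_\lambda',v_\lambda')$ is any other solution of $(S_\lambda)$, then $u_\lambda>u_\lambda'$ and $v_\lambda>v_\lambda'$ on $V$. Moreover, if $\lambda_1>\lambda_2>\lambda_c$, then $u_{\lambda_1}>u_{\lambda_2}$ and $v_{\lambda_1}>v_{\lambda_2}$ on $V$. (ii) If $0<\lambda<\lambda_c$, then $(S_\lambda)$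 admits no solution. (iii) If $\lambda=\lambda_c$, then $(S_{\lambda})$ admits a solution $(u_*,v_* )$ which satisfies $u_*<u_\lambda$ and $v_*<v_\lambda$ on $V$ for every $\lambda>\lambda_c$, where $(u_\lambda,v_\lambda)$ is the maximal solution from (i).
   Context: $(V,E)$ is a connected finite graph with vertex set $V$ and edge set $E$; $y\sim x$ means that $y$ is adjacent to $x$; $\omega_{xy}=\omega_{yx}>0$ is the weight of the edge $xy$. The $\mu$-Laplacian of $u:V\to\mathbb{R}$ is $$\Delta u(x)=\frac{1}{\mu(x)}\sum_{y\sim x}\omega_{xy}\,(u(y)-u(x)).$$ For $f:V\to\mathbb{R}$, $\int_V f\,d\mu=\sum_{x\in V}\mu(x)f(x)$, and $|V|=\int_V 1\,d\mu=\sum_{x\in V}\mu(x)$. $\delta_p$ denotes the Dirac delta mass at the vertex $p$ with respect to $\mu$: $\delta_p(p)=1/\mu(p)$ and $\delta_p(x)=0$ for $x\ne p$, so that $\int_V\delta_p\,d\mu=1$. The vertices $p_j'$ (respectively $p_j''$) need not be distinct. "Increasing" is understood in the weak sense (nondecreasing), so that constant functions such as $G\equiv 1$, $H\equiv1$ are allowed. Inequalities between functions, such as $u>u'$, mean $u(x)>u'(x)$ for every $x\in V$. *)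

theory Defs
  imports
    "HOL-Analysis.Analysis"
    "Graph_Theory.Pair_Digraph"
    "Graph_Theory.Digraph_Component"
begin

text \<open>
  An undirected simple graph is a symmetric, loop-free set of arcs (\<^locale>\<open>pair_graph\<close>);
  each edge \<open>xy\<close> is represented by the two arcs \<open>(x, y)\<close> and \<open>(y, x)\<close>.
\<close>

definition graph_laplacian ::
  "'a pair_pre_digraph \<Rightarrow> ('a \<Rightarrow> 'a \<Rightarrow> real) \<Rightarrow> ('a \<Rightarrow> real) \<Rightarrow> ('a \<Rightarrow> real) \<Rightarrow> 'a \<Rightarrow> real"
  where "graph_laplacian \<Gamma> \<omega> \<mu> u x =
    1 / \<mu> x * (\<Sum>y | (x, y) \<in> parcs \<Gamma>. \<omega> x y * (u y - u x))"

definition graph_integral :: "'a pair_pre_digraph \<Rightarrow> ('a \<Rightarrow> real) \<Rightarrow> ('a \<Rightarrow> real) \<Rightarrow> real"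
  where "graph_integral \<Gamma> \<mu> f = (\<Sum>x\<in>pverts \<Gamma>. \<mu> x * f x)"

definition graph_volume :: "'a pair_pre_digraph \<Rightarrow> ('a \<Rightarrow> real) \<Rightarrow> real"
  where "graph_volume \<Gamma> \<mu> = graph_integral \<Gamma> \<mu> (\<lambda>x. 1)"

definition dirac :: "('a \<Rightarrow> real) \<Rightarrow> 'a \<Rightarrow> 'a \<Rightarrow> real"
  where "dirac \<mu> p x = (if x = p then 1 / \<mu> p else 0)"

text \<open>
  Derivatives are taken within \<open>S\<close>, hence are one-sided at the endpoint of \<open>{0..}\<close>;
  \<open>D n\<close> is the \<open>n\<close>-th derivative.
\<close>

definition C_infinity_on :: "real set \<Rightarrow> (real \<Rightarrow> real) \<Rightarrow> bool"
  where "C_infinity_on S f \<longleftrightarrow>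
    (\<exists>D :: nat \<Rightarrow> real \<Rightarrow> real. (\<forall>x\<in>S. D 0 x = f x) \<and>
      (\<forall>n. \<forall>x\<in>S. (D n has_real_derivative D (Suc n) x) (at x within S)))"

text \<open>
  Functions on the vertex set are represented by total functions that are
  \<^const>\<open>extensional\<close> there, so that equality of solutions is equality on the vertex set.
\<close>

definition is_solution ::
  "'a pair_pre_digraph \<Rightarrow> ('a \<Rightarrow> 'a \<Rightarrow> real) \<Rightarrow> ('a \<Rightarrow> real) \<Rightarrow>
   (real \<Rightarrow> real) \<Rightarrow> (real \<Rightarrow> real) \<Rightarrow> (real \<Rightarrow> real) \<Rightarrow> (real \<Rightarrow> real) \<Rightarrow>
   nat \<Rightarrow> (nat \<Rightarrow> 'a) \<Rightarrow> nat \<Rightarrow> (nat \<Rightarrow> 'a) \<Rightarrow> real \<Rightarrow> ('a \<Rightarrow> real) \<Rightarrow> ('a \<Rightarrow> real) \<Rightarrow> bool"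
  where "is_solution \<Gamma> \<omega> \<mu> G H g h N1 p' N2 p'' lam u v \<longleftrightarrow>
    u \<in> extensional (pverts \<Gamma>) \<and> v \<in> extensional (pverts \<Gamma>) \<and>
    (\<forall>x\<in>pverts \<Gamma>.
      graph_laplacian \<Gamma> \<omega> \<mu> u x =
        - lam * exp (v x) * H (exp (v x)) * g (exp (u x)) + 4 * pi * (\<Sum>j=1..N1. dirac \<mu> (p' j) x) \<and>
      graph_laplacian \<Gamma> \<omega> \<mu> v x =
        - lam * exp (u x) * G (exp (u x)) * h (exp (v x)) + 4 * pi * (\<Sum>j=1..N2. dirac \<mu> (p'' j) x))"

definition is_maximal_solution ::
  "'a set \<Rightarrow> (('a \<Rightarrow> real) \<Rightarrow> ('a \<Rightarrow> real) \<Rightarrow> bool) \<Rightarrow> ('a \<Rightarrow> real) \<Rightarrow> ('a \<Rightarrow> real) \<Rightarrow> bool"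
  where "is_maximal_solution V sol u v \<longleftrightarrow> sol u v \<and>
    (\<forall>u' v'. sol u' v' \<and> (u', v') \<noteq> (u, v) \<longrightarrow> (\<forall>x\<in>V. u x > u' x \<and> v x > v' x))"

end

theory Submission
  imports Defs
begin

text \<open>
  On the region \<open>u, v \<le> 0\<close> the system is cooperative: there \<open>g(e\<^sup>u), h(e\<^sup>v) \<ge> 0\<close>, so the right-hand
  side of each equation is nonincreasing in the other unknown. By the maximum principle every
  solution lies in this region, in fact \<open>u, v < 0\<close> (\<open>solution_neg\<close>). The existence of a solution is
  therefore equivalent to the existence of a nonpositive subsolution, and Perron's method gives
  more: the pointwise supremum of all nonpositive subsolutions is itself a solution, and it lies
  above every other one (\<open>maximal_solution_above_subsolutions\<close>). A contact point of two ordered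
  solutions spreads along the edges, so on a connected graph distinct ordered solutions are strictly
  ordered (\<open>ordered_solutions_eq_if_contact\<close>).

  A solution for some \<open>\<lambda>\<close> is a strict subsolution for every larger parameter, because the
  nonlinear terms \<open>e\<^sup>v H(e\<^sup>v) g(e\<^sup>u)\<close> and \<open>e\<^sup>u G(e\<^sup>u) h(e\<^sup>v)\<close> are positive. Hence the parameters that admit
  a solution form an up-set, the critical parameter \<open>\<lambda>\<^sub>c\<close> is its infimum, and maximal solutions
  increase strictly with \<open>\<lambda>\<close> (\<open>maximal_strict_mono\<close>). The up-set is nonempty, since a negative
  constant is a subsolution for large \<open>\<lambda>\<close>. Integration of the equations over the graph shows that
  \<open>4 \<pi> N\<^sub>1 = \<lambda> \<integral> e\<^sup>v H(e\<^sup>v) g(e\<^sup>u) d\<mu>\<close>, which is at most \<open>\<lambda> H(1) G(1) |V|\<close>, and likewise for \<open>N\<^sub>2\<close>; this is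
  the lower bound on \<open>\<lambda>\<^sub>c\<close>.

  At \<open>\<lambda>\<^sub>c\<close> a solution is obtained as the limit of the maximal solutions for \<open>\<lambda> \<down> \<lambda>\<^sub>c\<close>. These decrease,
  so only a lower bound is needed (\<open>solutions_bounded_below\<close>). The Laplacians are bounded below,
  hence the oscillation of each unknown is bounded on the finite connected graph
  (\<open>oscillation_bound\<close>). So if \<open>u\<close> tended to \<open>-\<infinity>\<close> at one vertex, it would do so uniformly, and
  \<open>e\<^sup>u G(e\<^sup>u) h(e\<^sup>v)\<close> would tend to \<open>0\<close>, although its integral is \<open>4 \<pi> N\<^sub>2 / \<lambda>\<close>; the same holds for \<open>v\<close>.
\<close>

section \<open>The Laplacian of a connected weighted graph\<close>

locale weighted_graph =
  fixes \<Gamma> :: "'a pair_pre_digraph" and \<omega> :: "'a \<Rightarrow> 'a \<Rightarrow> real" and \<mu> :: "'a \<Rightarrow> real"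
  assumes graph: "pair_graph \<Gamma>"
    and conn: "Digraph_Component.connected (with_proj \<Gamma>)"
    and weight_pos: "\<And>x y. (x, y) \<in> parcs \<Gamma> \<Longrightarrow> \<omega> x y > 0"
    and weight_sym: "\<And>x y. (x, y) \<in> parcs \<Gamma> \<Longrightarrow> \<omega> x y = \<omega> y x"
    and measure_pos: "\<And>x. x \<in> pverts \<Gamma> \<Longrightarrow> \<mu> x > 0"
begin

abbreviation V :: "'a set" where "V \<equiv> pverts \<Gamma>"

abbreviation lap :: "('a \<Rightarrow> real) \<Rightarrow> 'a \<Rightarrow> real" where "lap \<equiv> graph_laplacian \<Gamma> \<omega> \<mu>"

definition weighted_degree :: "'a \<Rightarrow> real"
  where "weighted_degree x = (\<Sum>y | (x, y) \<in> parcs \<Gamma>. \<omega> x y)"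

definition neighbour_sum :: "('a \<Rightarrow> real) \<Rightarrow> 'a \<Rightarrow> real"
  where "neighbour_sum u x = (\<Sum>y | (x, y) \<in> parcs \<Gamma>. \<omega> x y * u y)"

lemma finite_V: "finite V"
  using graph by (simp add: pair_graph_def pair_digraph_def pair_fin_digraph_def pair_fin_digraph_axioms_def)

lemma arc_ends:
  assumes "(x, y) \<in> parcs \<Gamma>"
  shows "x \<in> V" "y \<in> V" "x \<noteq> y" "(y, x) \<in> parcs \<Gamma>"
proof -
  interpret pair_graph \<Gamma> by (fact graph)
  show "x \<in> V" "y \<in> V" using assms by (auto intro: in_arcsD1 in_arcsD2)
  show "x \<noteq> y" using pair_no_loops[OF assms] by simp
  show "(y, x) \<in> parcs \<Gamma>"
    using pair_sym_arcs assms by (auto simp: symmetric_def sym_def)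
qed

lemma finite_neighbours: "finite {y. (x, y) \<in> parcs \<Gamma>}"
  by (rule finite_subset[OF _ finite_V]) (auto dest: arc_ends)

lemma V_nonempty: "V \<noteq> {}"
  using conn by (auto simp: Digraph_Component.connected_def strongly_connected_def)

lemma connected_propagation:
  assumes "x \<in> V" "y \<in> V" "P x"
    and step: "\<And>a b. (a, b) \<in> parcs \<Gamma> \<Longrightarrow> P a \<Longrightarrow> P b"
  shows "P y"
proof -
  interpret pair_graph \<Gamma> by (fact graph)
  have "strongly_connected (with_proj \<Gamma>)"
    using symmetric_connected_imp_strongly_connected pair_sym_arcs conn by blast
  then have "x \<rightarrow>\<^sup>*\<^bsub>with_proj \<Gamma>\<^esub> y" using assms by (auto simp: strongly_connected_def)
  then show ?thesis
    by (induction rule: reachable_induct) (use assms in auto)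
qed

lemma measure_lap:
  assumes "x \<in> V"
  shows "\<mu> x * lap u x = neighbour_sum u x - weighted_degree x * u x"
  using measure_pos[OF assms]
  by (simp add: graph_laplacian_def neighbour_sum_def weighted_degree_def right_diff_distrib
      sum_subtractf sum_distrib_right)

lemma weighted_degree_nonneg: "weighted_degree x \<ge> 0"
  unfolding weighted_degree_def by (intro sum_nonneg) (auto dest: weight_pos less_imp_le)

lemma neighbour_sum_mono:
  assumes "\<And>y. y \<in> V \<Longrightarrow> u y \<le> w y"
  shows "neighbour_sum u x \<le> neighbour_sum w x"
  unfolding neighbour_sum_def
  by (intro sum_mono mult_left_mono assms) (auto dest: arc_ends weight_pos less_imp_le)

lemma lap_mono_at_contact:
  assumes "x \<in> V" "u x = w x" "\<And>y. y \<in> V \<Longrightarrow> u y \<le> w y"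
  shows "lap u x \<le> lap w x"
proof -
  have "\<mu> x * lap u x \<le> \<mu> x * lap w x"
    using neighbour_sum_mono[of u w x] assms by (simp add: measure_lap)
  then show ?thesis using measure_pos[OF \<open>x \<in> V\<close>] by simp
qed

text \<open>This is the strong maximum principle in its local form: contact at a point without a gain of
  the Laplacian there forces contact at all neighbours, because all weights are positive.\<close>

lemma contact_spreads:
  assumes arc: "(x, y) \<in> parcs \<Gamma>" and "u x = w x" "\<And>y. y \<in> V \<Longrightarrow> u y \<le> w y"
    and "lap w x \<le> lap u x"
  shows "u y = w y"
proof -
  have x: "x \<in> V" using arc by (auto dest: arc_ends)
  have "\<mu> x * lap w x \<le> \<mu> x * lap u x" using assms measure_pos[OF x] by simp
  then have le: "neighbour_sum w x \<le> neighbour_sum u x" using x assms by (simp add: measure_lap)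
  have nonneg: "\<omega> x z * (w z - u z) \<ge> 0" if "(x, z) \<in> parcs \<Gamma>" for z
    using assms(3)[OF arc_ends(2)[OF that]] weight_pos[OF that] by simp
  have "(\<Sum>z | (x, z) \<in> parcs \<Gamma>. \<omega> x z * (w z - u z)) \<le> 0"
    using le by (simp add: neighbour_sum_def right_diff_distrib sum_subtractf)
  then have "(\<Sum>z | (x, z) \<in> parcs \<Gamma>. \<omega> x z * (w z - u z)) = 0"
    using nonneg by (intro antisym sum_nonneg) auto
  then have "\<omega> x y * (w y - u y) = 0"
    using nonneg arc finite_neighbours by (subst (asm) sum_nonneg_eq_0_iff) auto
  then show ?thesis using weight_pos[OF arc] by simp
qed

lemma integral_lap: "(\<Sum>x\<in>V. \<mu> x * lap u x) = 0"
proof -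
  let ?w = "\<lambda>x y. if (x, y) \<in> parcs \<Gamma> then \<omega> x y else 0"
  have conv: "(\<Sum>y | (x, y) \<in> parcs \<Gamma>. \<omega> x y * k y) = (\<Sum>y\<in>V. ?w x y * k y)" for x k
    by (rule sum.mono_neutral_cong_left) (auto simp: finite_V dest: arc_ends)
  have "(\<Sum>x\<in>V. \<mu> x * lap u x) = (\<Sum>x\<in>V. \<Sum>y\<in>V. ?w x y * (u y - u x))"
    by (rule sum.cong[OF refl]) (use measure_pos conv in \<open>force simp: graph_laplacian_def\<close>)
  also have "\<dots> = (\<Sum>x\<in>V. \<Sum>y\<in>V. ?w x y * u y) - (\<Sum>x\<in>V. \<Sum>y\<in>V. ?w x y * u x)"
    by (simp add: right_diff_distrib sum_subtractf)
  also have "(\<Sum>x\<in>V. \<Sum>y\<in>V. ?w x y * u x) = (\<Sum>y\<in>V. \<Sum>x\<in>V. ?w x y * u x)"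
    by (rule sum.swap)
  also have "\<dots> = (\<Sum>x\<in>V. \<Sum>y\<in>V. ?w x y * u y)"
    by (intro sum.cong refl) (auto dest: arc_ends(4) weight_sym)
  finally show ?thesis by simp
qed

lemma tendsto_lap:
  assumes "\<And>y. y \<in> V \<Longrightarrow> ((\<lambda>n. u n y) \<longlongrightarrow> w y) F" "x \<in> V"
  shows "((\<lambda>n. lap (u n) x) \<longlongrightarrow> lap w x) F"
  unfolding graph_laplacian_def
  by (intro tendsto_intros assms) (auto dest: arc_ends)

text \<open>A Harnack-type estimate. If \<open>w\<close> attains its maximum \<open>m\<close> at \<open>x\<^sub>0\<close>, then \<open>m - w\<close> is
  nonnegative and a lower bound on \<open>\<Delta>w\<close> at \<open>x\<close> bounds \<open>m - w\<close> at each neighbour of \<open>x\<close> in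
  terms of its value at \<open>x\<close>; the bound \<open>0\<close> at \<open>x\<^sub>0\<close> then propagates through the connected graph.\<close>

lemma oscillation_bound_from_max:
  assumes x0: "x0 \<in> V" and y: "y \<in> V"
  shows "\<exists>B. \<forall>w. (\<forall>x\<in>V. - C \<le> lap w x \<and> w x \<le> w x0) \<longrightarrow> w x0 - w y \<le> B"
    (is "?P y")
  using x0 y
proof (rule connected_propagation[where P = ?P])
  show "?P x0" by (rule exI[of _ 0]) auto
next
  fix a b
  assume ab: "(a, b) \<in> parcs \<Gamma>" and "?P a"
  then obtain B where B: "\<And>w. \<forall>x\<in>V. - C \<le> lap w x \<and> w x \<le> w x0 \<Longrightarrow> w x0 - w a \<le> B" by blast
  have a: "a \<in> V" using ab by (auto dest: arc_ends)
  show "?P b"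
  proof (intro exI allI impI)
    fix w assume w: "\<forall>x\<in>V. - C \<le> lap w x \<and> w x \<le> w x0"
    let ?d = "\<lambda>z. w x0 - w z"
    have "\<omega> a b * ?d b \<le> neighbour_sum ?d a"
      unfolding neighbour_sum_def
      by (rule member_le_sum[of b _ "\<lambda>z. \<omega> a z * ?d z"])
        (use ab w finite_neighbours arc_ends(2) weight_pos in \<open>auto simp: less_imp_le\<close>)
    also have "\<dots> = weighted_degree a * w x0 - neighbour_sum w a"
      by (simp add: neighbour_sum_def weighted_degree_def right_diff_distrib sum_subtractf
          sum_distrib_right)
    also have "\<dots> = weighted_degree a * ?d a - \<mu> a * lap w a"
      using a by (simp add: measure_lap algebra_simps)
    also have "\<dots> \<le> weighted_degree a * B + \<mu> a * C"
    proof -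
      have "weighted_degree a * ?d a \<le> weighted_degree a * B"
        using B[OF w] weighted_degree_nonneg by (intro mult_left_mono)
      moreover have "\<mu> a * (- C) \<le> \<mu> a * lap w a"
        using w a measure_pos[OF a] by (intro mult_left_mono) auto
      ultimately show ?thesis by simp
    qed
    finally show "?d b \<le> (weighted_degree a * B + \<mu> a * C) / \<omega> a b"
      using weight_pos[OF ab] by (simp add: field_simps)
  qed
qed

lemma oscillation_bound:
  "\<exists>B. \<forall>w. (\<forall>x\<in>V. - C \<le> lap w x) \<longrightarrow> (\<forall>x\<in>V. \<forall>y\<in>V. w x - w y \<le> B)"
proof -
  have "\<forall>p\<in>V \<times> V. \<exists>B. \<forall>w. (\<forall>x\<in>V. - C \<le> lap w x \<and> w x \<le> w (fst p)) \<longrightarrow> w (fst p) - w (snd p) \<le> B"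
    using oscillation_bound_from_max by auto
  then obtain b where b: "\<And>w x0 y. x0 \<in> V \<Longrightarrow> y \<in> V \<Longrightarrow>
      \<forall>x\<in>V. - C \<le> lap w x \<and> w x \<le> w x0 \<Longrightarrow> w x0 - w y \<le> b (x0, y)"
    unfolding bchoice_iff by (metis SigmaI fst_conv snd_conv)
  show ?thesis
  proof (intro exI allI impI ballI)
    fix w x y assume w: "\<forall>x\<in>V. - C \<le> lap w x" and x: "x \<in> V" and y: "y \<in> V"
    have fin: "finite (w ` V)" "w ` V \<noteq> {}" using finite_V V_nonempty by auto
    obtain x0 where x0: "x0 \<in> V" "w x0 = Max (w ` V)" using Max_in[OF fin] by auto
    have max: "w z \<le> w x0" if "z \<in> V" for z using that fin x0 by simp
    have "w x - w y \<le> w x0 - w y" using max[OF x] by simp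
    also have "\<dots> \<le> b (x0, y)" using b[OF x0(1) y, of w] w max by blast
    also have "\<dots> \<le> \<bar>b (x0, y)\<bar>" by simp
    also have "\<dots> \<le> (\<Sum>p\<in>V \<times> V. \<bar>b p\<bar>)"
      by (rule member_le_sum[of "(x0, y)" _ "\<lambda>p. \<bar>b p\<bar>"]) (use x0 y finite_V in auto)
    finally show "w x - w y \<le> (\<Sum>p\<in>V \<times> V. \<bar>b p\<bar>)" .
  qed
qed

end

section \<open>Solutions and subsolutions of the cooperative system\<close>

text \<open>The pair \<open>(u, v)\<close> is a single family \<open>U\<close> with \<open>U True = u\<close> and \<open>U False = v\<close>. Both equations
  of the system then have the form \<open>\<Delta>(U i) = - \<lambda> \<phi>\<^sub>i(U (\<not> i)) \<gamma>\<^sub>i(U i) + f\<^sub>i\<close>, so that every argument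
  for \<open>u\<close> is also the argument for \<open>v\<close>.\<close>

locale cooperative_system = weighted_graph +
  fixes \<phi> \<gamma> :: "bool \<Rightarrow> real \<Rightarrow> real" and f :: "bool \<Rightarrow> 'a \<Rightarrow> real" and c :: "bool \<Rightarrow> real"
  assumes \<phi>_cont: "\<And>i t. isCont (\<phi> i) t"
    and \<phi>_mono: "\<And>i s t. s < t \<Longrightarrow> \<phi> i s < \<phi> i t"
    and \<phi>_pos: "\<And>i t. 0 < \<phi> i t"
    and \<phi>_lim: "\<And>i. (\<phi> i \<longlongrightarrow> 0) at_bot"
    and \<gamma>_cont: "\<And>i t. isCont (\<gamma> i) t"
    and \<gamma>_anti: "\<And>i s t. s < t \<Longrightarrow> \<gamma> i t < \<gamma> i s"
    and \<gamma>_zero: "\<And>i. \<gamma> i 0 = 0"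
    and \<gamma>_bound: "\<And>i t. \<gamma> i t \<le> c i"
    and f_nonneg: "\<And>i x. x \<in> V \<Longrightarrow> f i x \<ge> 0"
    and f_pos: "\<And>i. \<exists>x\<in>V. f i x > 0"
begin

definition rhs :: "real \<Rightarrow> (bool \<Rightarrow> 'a \<Rightarrow> real) \<Rightarrow> bool \<Rightarrow> 'a \<Rightarrow> real"
  where "rhs lam U i x = - lam * \<phi> i (U (\<not> i) x) * \<gamma> i (U i x) + f i x"

definition solution :: "real \<Rightarrow> (bool \<Rightarrow> 'a \<Rightarrow> real) \<Rightarrow> bool"
  where "solution lam U \<longleftrightarrow> (\<forall>i. \<forall>x\<in>V. lap (U i) x = rhs lam U i x)"

text \<open>The sign constraint is part of the notion because the system is cooperative (the right-hand
  side of each equation is nonincreasing in the other unknown) only where \<open>\<gamma>\<^sub>i(U i) \<ge> 0\<close>.\<close>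

definition subsolution :: "real \<Rightarrow> (bool \<Rightarrow> 'a \<Rightarrow> real) \<Rightarrow> bool"
  where "subsolution lam U \<longleftrightarrow> (\<forall>i. \<forall>x\<in>V. U i x \<le> 0 \<and> rhs lam U i x \<le> lap (U i) x)"

definition maximal :: "real \<Rightarrow> (bool \<Rightarrow> 'a \<Rightarrow> real) \<Rightarrow> bool"
  where "maximal lam U \<longleftrightarrow> solution lam U \<and>
    (\<forall>W. solution lam W \<longrightarrow> (\<forall>i. \<forall>x\<in>V. W i x \<le> U i x))"

lemma solution_lap: "solution lam U \<Longrightarrow> x \<in> V \<Longrightarrow> lap (U i) x = rhs lam U i x"
  by (auto simp: solution_def)

lemma \<phi>_le: "s \<le> t \<Longrightarrow> \<phi> i s \<le> \<phi> i t"
  using \<phi>_mono[of s t i] by (cases "s = t") auto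

lemma \<gamma>_le: "s \<le> t \<Longrightarrow> \<gamma> i t \<le> \<gamma> i s"
  using \<gamma>_anti[of s t i] by (cases "s = t") auto

lemma \<gamma>_pos: "t < 0 \<Longrightarrow> 0 < \<gamma> i t"
  using \<gamma>_anti[of t 0 i] by (simp add: \<gamma>_zero)

lemma \<gamma>_neg: "0 < t \<Longrightarrow> \<gamma> i t < 0"
  using \<gamma>_anti[of 0 t i] by (simp add: \<gamma>_zero)

lemma \<gamma>_nonneg: "t \<le> 0 \<Longrightarrow> 0 \<le> \<gamma> i t"
  using \<gamma>_le[of t 0 i] by (simp add: \<gamma>_zero)

lemma \<phi>_inj: "\<phi> i s = \<phi> i t \<Longrightarrow> s = t"
  using \<phi>_mono[of s t i] \<phi>_mono[of t s i] by (cases s t rule: linorder_cases) auto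

lemma c_pos: "0 < c i"
  using \<gamma>_pos[of "-1" i] \<gamma>_bound[of i "-1"] by simp

lemma measure_f_pos: "0 < (\<Sum>x\<in>V. \<mu> x * f i x)"
proof -
  obtain x where "x \<in> V" "0 < f i x" using f_pos by blast
  then show ?thesis
    by (intro sum_pos2[of V x]) (auto simp: finite_V measure_pos f_nonneg less_imp_le)
qed

text \<open>The maximum principle. At a maximum of \<open>U i\<close> the Laplacian is nonpositive, while the
  right-hand side at a positive value is positive; a maximum equal to \<open>0\<close> spreads over the whole graph, where it contradicts \<open>f\<^sub>i \<noteq> 0\<close>.\<close>

lemma solution_neg:
  assumes sol: "solution lam U" and lam: "0 < lam" and x: "x \<in> V"
  shows "U i x < 0"
proof -
  have fin: "finite (U i ` V)" "U i ` V \<noteq> {}" using finite_V V_nonempty by auto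
  obtain x0 where x0: "x0 \<in> V" "U i x0 = Max (U i ` V)" using Max_in[OF fin] by auto
  have max: "U i z \<le> U i x0" if "z \<in> V" for z using that fin x0 by simp
  have lap_const: "lap (\<lambda>_. k) z = 0" for k z by (simp add: graph_laplacian_def)
  have lap_max: "lap (U i) z \<le> 0" if "z \<in> V" "U i z = U i x0" for z
    using lap_mono_at_contact[of z "U i" "\<lambda>_. U i x0"] that max lap_const by auto
  have "\<not> 0 < U i x0"
  proof
    assume "0 < U i x0"
    then have "lam * \<phi> i (U (\<not> i) x0) * \<gamma> i (U i x0) < 0"
      using lam \<phi>_pos \<gamma>_neg by (intro mult_pos_neg mult_pos_pos) auto
    then show False
      using solution_lap[OF sol x0(1), of i] lap_max[OF x0(1)] f_nonneg[OF x0(1), of i]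
      by (simp add: rhs_def)
  qed
  moreover have "U i x0 \<noteq> 0"
  proof
    assume 0: "U i x0 = 0"
    have zero: "U i y = 0" if "y \<in> V" for y
    proof (rule connected_propagation[OF x0(1) that, where P = "\<lambda>y. U i y = 0", OF 0])
      fix a b assume ab: "(a, b) \<in> parcs \<Gamma>" and a0: "U i a = 0"
      then have a: "a \<in> V" by (auto dest: arc_ends)
      have "lap (U i) a = f i a" using solution_lap[OF sol a, of i] a0 by (simp add: rhs_def \<gamma>_zero)
      then show "U i b = 0"
        using contact_spreads[OF ab, of "U i" "\<lambda>_. 0"] a0 max 0 lap_const f_nonneg[OF a, of i] by auto
    qed
    obtain y where y: "y \<in> V" "f i y > 0" using f_pos by blast
    have "lap (U i) y = f i y"
      using solution_lap[OF sol y(1), of i] zero[OF y(1)] by (simp add: rhs_def \<gamma>_zero)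
    then show False using lap_max[OF y(1)] zero[OF y(1)] 0 y by simp
  qed
  ultimately show ?thesis using max[OF x] by simp
qed

lemma solution_imp_subsolution: "solution lam U \<Longrightarrow> 0 < lam \<Longrightarrow> subsolution lam U"
  by (auto simp: subsolution_def solution_lap intro: less_imp_le solution_neg)

subsection \<open>The largest subsolution\<close>

text \<open>All occurrences of \<open>t = U i x\<close> in the subsolution inequality at \<open>x\<close>, including the one in
  \<open>\<Delta>(U i)\<close>, are collected on one side; the other side is the neighbour sum. What remains is a bound
  on a continuous function of the single number \<open>t\<close>, which passes to suprema over subsolutions and,
  where it is strict, leaves room to raise \<open>t\<close>.\<close>

definition local_balance :: "real \<Rightarrow> bool \<Rightarrow> 'a \<Rightarrow> real \<Rightarrow> real \<Rightarrow> real"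
  where "local_balance lam i x s t =
    weighted_degree x * t + \<mu> x * (- lam * \<phi> i s * \<gamma> i t + f i x)"

lemma rhs_le_lap_iff:
  assumes "x \<in> V"
  shows "rhs lam U i x \<le> lap (U i) x \<longleftrightarrow>
    local_balance lam i x (U (\<not> i) x) (U i x) \<le> neighbour_sum (U i) x"
proof -
  have "rhs lam U i x \<le> lap (U i) x \<longleftrightarrow> \<mu> x * rhs lam U i x \<le> \<mu> x * lap (U i) x"
    using measure_pos[OF assms] by simp
  then show ?thesis using assms by (simp add: measure_lap local_balance_def rhs_def) linarith
qed

lemma local_balance_anti:
  assumes "0 < lam" "x \<in> V" "s \<le> s'" "t \<le> 0"
  shows "local_balance lam i x s' t \<le> local_balance lam i x s t"
proof -
  have "\<phi> i s * \<gamma> i t \<le> \<phi> i s' * \<gamma> i t"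
    using assms by (intro mult_right_mono \<phi>_le \<gamma>_nonneg)
  then have "lam * (\<phi> i s * \<gamma> i t) \<le> lam * (\<phi> i s' * \<gamma> i t)" using assms by simp
  then show ?thesis using measure_pos[OF \<open>x \<in> V\<close>] by (simp add: local_balance_def mult.assoc)
qed

lemma isCont_local_balance: "isCont (local_balance lam i x s) t"
  unfolding local_balance_def by (intro continuous_intros \<gamma>_cont)

lemma local_balance_zero: "x \<in> V \<Longrightarrow> 0 \<le> local_balance lam i x s 0"
  using f_nonneg[of x i] measure_pos[of x] by (simp add: local_balance_def \<gamma>_zero)

text \<open>Perron's method. The pointwise supremum \<open>W\<close> of all subsolutions is a subsolution: raising the
  neighbours and the other unknown to \<open>W\<close> relaxes each inequality, and the remaining variable
  passes to its supremum by continuity. If \<open>W\<close> were not a solution, one of its values could be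
  raised a little without leaving the set of subsolutions.\<close>

lemma maximal_solution_above_subsolutions:
  assumes sub0: "subsolution lam U0" and lam: "0 < lam"
  obtains W where "solution lam W"
    and "\<And>U i x. subsolution lam U \<Longrightarrow> x \<in> V \<Longrightarrow> U i x \<le> W i x"
proof -
  define A where "A i x = (\<lambda>U. U i x) ` {U. subsolution lam U}" for i x
  define W where "W i x = Sup (A i x)" for i x
  have A_ne: "A i x \<noteq> {}" for i x using sub0 by (auto simp: A_def)
  have A_le: "t \<le> 0" if "t \<in> A i x" "x \<in> V" for t i x
    using that by (auto simp: A_def subsolution_def)
  have A_bdd: "bdd_above (A i x)" if "x \<in> V" for i x
    using A_le[OF _ that] by (intro bdd_aboveI) auto
  have W_ge: "U i x \<le> W i x" if "subsolution lam U" "x \<in> V" for U i x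
    unfolding W_def using that by (intro cSup_upper A_bdd) (auto simp: A_def)
  have W_le: "W i x \<le> 0" if "x \<in> V" for i x
    unfolding W_def using A_ne A_le[OF _ that] by (intro cSup_least) auto
  have W_bal: "local_balance lam i x (W (\<not> i) x) (W i x) \<le> neighbour_sum (W i) x"
    (is "?q (W i x) \<le> ?S") if x: "x \<in> V" for i x
  proof -
    have "?q t \<le> ?S" if "t \<in> A i x" for t
    proof -
      obtain U where U: "subsolution lam U" "t = U i x" using \<open>t \<in> A i x\<close> by (auto simp: A_def)
      have "?q t \<le> local_balance lam i x (U (\<not> i) x) t"
        using U x lam W_ge by (intro local_balance_anti) (auto simp: subsolution_def)
      also have "\<dots> \<le> neighbour_sum (U i) x"
        using U x rhs_le_lap_iff[OF x, of lam U i] by (auto simp: subsolution_def)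
      also have "\<dots> \<le> ?S" using U W_ge by (intro neighbour_sum_mono)
      finally show ?thesis .
    qed
    then have "A i x \<subseteq> {t. ?q t \<le> ?S}" by auto
    moreover have "closed {t. ?q t \<le> ?S}"
      by (intro closed_Collect_le continuous_at_imp_continuous_on ballI isCont_local_balance
          continuous_on_const)
    ultimately have "closure (A i x) \<subseteq> {t. ?q t \<le> ?S}" by (rule closure_minimal)
    moreover have "W i x \<in> closure (A i x)"
      unfolding W_def by (rule closure_contains_Sup[OF A_ne A_bdd[OF x]])
    ultimately show ?thesis by auto
  qed
  have W_eq: "neighbour_sum (W i) x \<le> local_balance lam i x (W (\<not> i) x) (W i x)"
    if x: "x \<in> V" for i x
  proof (rule ccontr)
    let ?q = "local_balance lam i x (W (\<not> i) x)" and ?S = "neighbour_sum (W i) x"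
    assume "\<not> ?S \<le> ?q (W i x)"
    then have less: "?q (W i x) < ?S" by simp
    \<comment> \<open>A value \<open>0\<close> could not be raised, but there the right-hand side is \<open>f i x \<ge> 0\<close> and the
      Laplacian of \<open>W i \<le> 0\<close> is nonpositive, which excludes strict inequality.\<close>
    have "W i x \<noteq> 0"
    proof
      assume "W i x = 0"
      then have "0 < ?S" using less local_balance_zero[OF x, of lam i "W (\<not> i) x"] by simp
      moreover have "?S \<le> neighbour_sum (\<lambda>_. 0) x" by (intro neighbour_sum_mono W_le)
      ultimately show False by (simp add: neighbour_sum_def)
    qed
    then have neg: "W i x < 0" using W_le[OF x, of i] by simp
    have "eventually (\<lambda>t. ?q t < ?S) (at_right (W i x))"
      using isCont_local_balance[of "W i x" lam i x "W (\<not> i) x"] less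
      by (intro order_tendstoD) (auto simp: isCont_def filterlim_at_split)
    moreover have "eventually (\<lambda>t. t < 0) (at_right (W i x))"
      using neg by (intro order_tendstoD(2)[OF tendsto_ident_at])
    moreover have "eventually (\<lambda>t. W i x < t) (at_right (W i x))"
      by (rule eventually_at_right_less)
    ultimately have "eventually (\<lambda>t. ?q t < ?S \<and> t < 0 \<and> W i x < t) (at_right (W i x))"
      by (intro eventually_conj)
    then obtain t where t: "?q t < ?S" "t < 0" "W i x < t"
      using eventually_happens[of _ "at_right (W i x)"] by (auto simp: trivial_limit_at_right_real)
    define U where "U = W(i := (W i)(x := t))"
    have U_ge: "W j y \<le> U j y" for j y using t by (auto simp: U_def)
    have U_le: "U j y \<le> 0" if "y \<in> V" for j y using t W_le that by (auto simp: U_def)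
    have "subsolution lam U"
      unfolding subsolution_def
    proof (intro allI ballI conjI U_le)
      fix j y assume y: "y \<in> V"
      show "rhs lam U j y \<le> lap (U j) y"
      proof (cases "j = i \<and> y = x")
        case True
        \<comment> \<open>The graph has no loops, so the neighbour sum at \<open>x\<close> is not affected.\<close>
        have "neighbour_sum (U i) x = ?S"
          unfolding neighbour_sum_def by (intro sum.cong refl) (auto simp: U_def dest: arc_ends(3))
        then show ?thesis using True t x by (simp add: rhs_le_lap_iff) (simp add: U_def)
      next
        case False
        then have [simp]: "U j y = W j y" by (auto simp: U_def)
        have "local_balance lam j y (U (\<not> j) y) (U j y) \<le> local_balance lam j y (W (\<not> j) y) (W j y)"
          using lam y U_ge W_le by (simp add: local_balance_anti)
        also have "\<dots> \<le> neighbour_sum (W j) y" by (rule W_bal[OF y])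
        also have "\<dots> \<le> neighbour_sum (U j) y" by (intro neighbour_sum_mono U_ge)
        finally show ?thesis using y by (simp add: rhs_le_lap_iff)
      qed
    qed
    then have "U i x \<le> W i x" using W_ge x by blast
    then show False using t by (simp add: U_def)
  qed
  have "solution lam W"
    unfolding solution_def
  proof (intro allI ballI)
    fix i x assume x: "x \<in> V"
    have "neighbour_sum (W i) x = local_balance lam i x (W (\<not> i) x) (W i x)"
      using W_bal[OF x, of i] W_eq[OF x, of i] by simp
    then have "\<mu> x * lap (W i) x = \<mu> x * rhs lam W i x"
      using x by (simp add: measure_lap local_balance_def rhs_def)
    then show "lap (W i) x = rhs lam W i x" using measure_pos[OF x] by simp
  qed
  then show thesis using that W_ge by blast
qed

lemma maximal_if_subsolution:
  assumes "subsolution lam U" "0 < lam"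
  obtains W where "maximal lam W" "\<And>i x. x \<in> V \<Longrightarrow> U i x \<le> W i x"
proof -
  obtain W where W: "solution lam W" "\<And>U i x. subsolution lam U \<Longrightarrow> x \<in> V \<Longrightarrow> U i x \<le> W i x"
    using maximal_solution_above_subsolutions[OF assms] by blast
  then have "maximal lam W"
    using assms(2) by (auto simp: maximal_def intro: solution_imp_subsolution)
  then show thesis using that W(2) assms(1) by blast
qed

subsection \<open>Strict comparison\<close>

text \<open>Contact of one component at \<open>x\<close> forces contact of the other one there, since \<open>\<gamma>\<^sub>i > 0\<close> on
  negative values and \<open>\<phi>\<^sub>i\<close> is injective; then both spread to all neighbours.\<close>

lemma ordered_solutions_eq_if_contact:
  assumes W: "solution lam W" and U: "solution lam U" and lam: "0 < lam"
    and le: "\<And>i x. x \<in> V \<Longrightarrow> W i x \<le> U i x"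
    and x: "x \<in> V" and contact: "W i x = U i x" and y: "y \<in> V"
  shows "W j y = U j y"
proof -
  have both: "W (\<not> i) x = U (\<not> i) x"
  proof -
    have "lap (W i) x \<le> lap (U i) x"
      using lap_mono_at_contact[of x "W i" "U i"] x contact le by blast
    then have "lam * (\<phi> i (U (\<not> i) x) * \<gamma> i (U i x)) \<le> lam * (\<phi> i (W (\<not> i) x) * \<gamma> i (U i x))"
      using x U W by (simp add: solution_lap rhs_def contact mult.assoc)
    then have "\<phi> i (U (\<not> i) x) \<le> \<phi> i (W (\<not> i) x)"
      using lam \<gamma>_pos[OF solution_neg[OF U lam x], of i i] by simp
    then show ?thesis using \<phi>_le[OF le[OF x], of i "\<not> i"] \<phi>_inj by force
  qed
  have "\<forall>k. W k y = U k y"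
  proof (rule connected_propagation[OF x y, where P = "\<lambda>y. \<forall>k. W k y = U k y"])
    show "\<forall>k. W k x = U k x" using both contact by (cases i) (simp_all add: all_bool_eq)
  next
    fix a b assume ab: "(a, b) \<in> parcs \<Gamma>" and eq: "\<forall>k. W k a = U k a"
    then have a: "a \<in> V" by (auto dest: arc_ends)
    have "lap (U k) a = lap (W k) a" for k
      using a U W eq by (simp add: solution_lap rhs_def)
    then show "\<forall>k. W k b = U k b"
      using contact_spreads[OF ab] eq le by (metis order_refl)
  qed
  then show ?thesis by blast
qed

lemma maximal_strict:
  assumes "maximal lam U" "solution lam W" "0 < lam" and "z \<in> V" "W j z \<noteq> U j z" and "x \<in> V"
  shows "W i x < U i x"
  using assms ordered_solutions_eq_if_contact[of lam W U x i z j] by (force simp: maximal_def less_le)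

text \<open>Since \<open>\<phi>\<^sub>i \<gamma>\<^sub>i > 0\<close> at negative values, a larger \<open>\<lambda>\<close> lowers the right-hand side.\<close>

lemma solution_imp_subsolution_larger:
  assumes sol: "solution lam' W" and lam: "0 < lam'" "lam' \<le> lam"
  shows "subsolution lam W"
  unfolding subsolution_def
proof (intro allI ballI conjI)
  fix i x assume x: "x \<in> V"
  have neg: "W i x < 0" by (rule solution_neg[OF sol lam(1) x])
  then show "W i x \<le> 0" by simp
  have "lam' * (\<phi> i (W (\<not> i) x) * \<gamma> i (W i x)) \<le> lam * (\<phi> i (W (\<not> i) x) * \<gamma> i (W i x))"
    using lam \<phi>_pos[of i "W (\<not> i) x"] \<gamma>_pos[OF neg, of i] by (intro mult_right_mono) auto
  then show "rhs lam W i x \<le> lap (W i) x"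
    using solution_lap[OF sol x, of i] by (simp add: rhs_def mult.assoc)
qed

lemma maximal_strict_mono:
  assumes max: "maximal lam U" and sol: "solution lam' W" and lam: "0 < lam'" "lam' < lam"
    and x: "x \<in> V"
  shows "W i x < U i x"
proof -
  have lam0: "0 < lam" using lam by simp
  have solU: "solution lam U" using max by (simp add: maximal_def)
  have sub: "subsolution lam W" using solution_imp_subsolution_larger[OF sol] lam by simp
  obtain M where M: "maximal lam M" "\<And>i x. x \<in> V \<Longrightarrow> W i x \<le> M i x"
    using maximal_if_subsolution[OF sub lam0] by blast
  have le: "W j y \<le> U j y" if "y \<in> V" for j y
    using M that max by (meson maximal_def order_trans)
  have "W i x \<noteq> U i x"
  proof
    assume contact: "W i x = U i x"
    have neg: "U i x < 0" by (rule solution_neg[OF solU lam0 x])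
    have "lap (W i) x \<le> lap (U i) x" using lap_mono_at_contact[of x "W i" "U i"] x contact le by simp
    then have "lam * \<phi> i (U (\<not> i) x) * \<gamma> i (U i x) \<le> lam' * \<phi> i (W (\<not> i) x) * \<gamma> i (U i x)"
      using x solU sol by (simp add: solution_lap rhs_def contact)
    then have "lam * \<phi> i (U (\<not> i) x) \<le> lam' * \<phi> i (W (\<not> i) x)"
      using \<gamma>_pos[OF neg, of i] by simp
    moreover have "lam' * \<phi> i (W (\<not> i) x) < lam * \<phi> i (U (\<not> i) x)"
      using lam \<phi>_pos \<phi>_le le x by (intro mult_less_le_imp_less) (auto intro: less_imp_le)
    ultimately show False by simp
  qed
  then show ?thesis using le[OF x, of i] by simp
qed

section \<open>The critical parameter\<close>

text \<open>At a negative constant the Laplacian vanishes and \<open>\<phi>\<^sub>i \<gamma>\<^sub>i\<close> is a positive constant, so a large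
  \<open>\<lambda>\<close> outweighs the bounded sources.\<close>

lemma subsolution_for_large_parameter: "\<exists>lam>0. subsolution lam (\<lambda>_ _. - 1)"
proof -
  define m where "m i = \<phi> i (- 1) * \<gamma> i (- 1)" for i
  have m: "0 < m i" for i unfolding m_def using \<phi>_pos \<gamma>_pos by (intro mult_pos_pos) auto
  define K where "K i = (\<Sum>x\<in>V. f i x) / m i" for i
  have f_le: "f i x \<le> K i * m i" if "x \<in> V" for i x
    using member_le_sum[of x V "f i"] that f_nonneg finite_V m[of i] by (simp add: K_def)
  have K: "0 \<le> K i" for i unfolding K_def using m f_nonneg by (intro divide_nonneg_pos sum_nonneg) auto
  define L where "L = K True + K False + 1"
  have L: "K i \<le> L" for i using K[of True] K[of False] by (cases i) (auto simp: L_def)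
  have "0 < L" using K[of True] K[of False] by (simp add: L_def)
  moreover have "subsolution L (\<lambda>_ _. - 1)"
    unfolding subsolution_def
  proof (intro allI ballI conjI)
    fix i x assume x: "x \<in> V"
    have "f i x \<le> K i * m i" using f_le[OF x] .
    also have "\<dots> \<le> L * m i" using L m[of i] by (intro mult_right_mono) auto
    finally show "rhs L (\<lambda>_ _. - 1) i x \<le> lap (\<lambda>_. - 1) x"
      by (simp add: rhs_def graph_laplacian_def m_def mult.assoc)
  qed simp
  ultimately show ?thesis by blast
qed

lemma source_balance:
  assumes "solution lam U"
  shows "(\<Sum>x\<in>V. \<mu> x * f i x) = lam * (\<Sum>x\<in>V. \<mu> x * (\<phi> i (U (\<not> i) x) * \<gamma> i (U i x)))"
proof -
  have "0 = (\<Sum>x\<in>V. \<mu> x * lap (U i) x)" by (rule integral_lap[symmetric])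
  also have "\<dots> = (\<Sum>x\<in>V. \<mu> x * f i x - lam * (\<mu> x * (\<phi> i (U (\<not> i) x) * \<gamma> i (U i x))))"
    using assms by (intro sum.cong refl) (simp add: solution_lap rhs_def algebra_simps)
  finally show ?thesis by (simp add: sum_subtractf sum_distrib_left)
qed

text \<open>A bound \<open>e\<close> on the values of \<open>\<phi>\<^sub>i\<close> limits the total mass of the sources; it is used with
  \<open>e = \<phi>\<^sub>i(0)\<close> for the lower bound on \<open>\<lambda>\<close>, and with small \<open>e\<close> to keep solutions away from \<open>-\<infinity>\<close>.\<close>

lemma source_mass_le:
  assumes sol: "solution lam U" and lam: "0 < lam"
    and e: "\<And>x. x \<in> V \<Longrightarrow> \<phi> i (U (\<not> i) x) \<le> e"
  shows "(\<Sum>x\<in>V. \<mu> x * f i x) \<le> lam * (e * c i * graph_volume \<Gamma> \<mu>)"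
proof -
  have "\<mu> x * (\<phi> i (U (\<not> i) x) * \<gamma> i (U i x)) \<le> \<mu> x * (e * c i)" if x: "x \<in> V" for x
  proof -
    have "0 < \<gamma> i (U i x)" by (intro \<gamma>_pos solution_neg[OF sol lam x])
    moreover have "0 < e" using \<phi>_pos[of i "U (\<not> i) x"] e[OF x] by linarith
    ultimately have "\<phi> i (U (\<not> i) x) * \<gamma> i (U i x) \<le> e * c i"
      using e[OF x] \<gamma>_bound by (intro mult_mono) auto
    then show ?thesis using measure_pos[OF x] by simp
  qed
  then have "(\<Sum>x\<in>V. \<mu> x * (\<phi> i (U (\<not> i) x) * \<gamma> i (U i x))) \<le> (\<Sum>x\<in>V. \<mu> x * (e * c i))"
    by (rule sum_mono)
  also have "\<dots> = e * c i * graph_volume \<Gamma> \<mu>"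
    by (simp add: graph_volume_def graph_integral_def sum_distrib_right[symmetric] mult.commute)
  finally show ?thesis using source_balance[OF sol, of i] lam by simp
qed

lemma source_mass_le_parameter:
  assumes sol: "solution lam U" and lam: "0 < lam"
  shows "(\<Sum>x\<in>V. \<mu> x * f i x) \<le> lam * (\<phi> i 0 * c i * graph_volume \<Gamma> \<mu>)"
  by (rule source_mass_le[OF sol lam]) (intro \<phi>_le less_imp_le solution_neg[OF sol lam])

lemma volume_pos: "0 < graph_volume \<Gamma> \<mu>"
  unfolding graph_volume_def graph_integral_def
  using finite_V V_nonempty measure_pos by (auto intro: sum_pos)

text \<open>Solutions with bounded \<open>\<lambda>\<close> cannot escape to \<open>-\<infinity>\<close>. The source mass in the equation for the
  other unknown prevents \<open>U i\<close> from being very negative everywhere, and the oscillation of \<open>U i\<close> is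
  bounded because \<open>\<Delta>(U i)\<close> is bounded below.\<close>

lemma solutions_bounded_below:
  "\<exists>b. \<forall>lam U. 0 < lam \<and> lam \<le> L \<and> solution lam U \<longrightarrow> (\<forall>x\<in>V. b \<le> U i x)"
proof (cases "0 < L")
  case L: True
  define C where "C = L * (\<phi> i 0 * c i)"
  obtain B where B: "\<And>w x y. \<forall>x\<in>V. - C \<le> lap w x \<Longrightarrow> x \<in> V \<Longrightarrow> y \<in> V \<Longrightarrow> w x - w y \<le> B"
    using oscillation_bound[of C] by blast
  define j where "j = (\<not> i)"
  define M where "M = (\<Sum>x\<in>V. \<mu> x * f j x)"
  \<comment> \<open>With this \<open>e\<close> the mass bound \<open>source_mass_le\<close> would give \<open>M \<le> M / 2\<close>.\<close>
  define e where "e = M / (2 * (L * (c j * graph_volume \<Gamma> \<mu>)))"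
  have M: "0 < M" unfolding M_def by (rule measure_f_pos)
  have D: "0 < L * (c j * graph_volume \<Gamma> \<mu>)" using L c_pos volume_pos by simp
  have e: "0 < e" using M D by (simp add: e_def)
  have "eventually (\<lambda>t. \<phi> j t < e) at_bot" by (rule order_tendstoD(2)[OF \<phi>_lim e])
  then obtain K where K: "\<And>t. t \<le> K \<Longrightarrow> \<phi> j t < e" by (auto simp: eventually_at_bot_linorder)
  show ?thesis
  proof (intro exI[of _ "K - B"] allI impI ballI)
    fix lam U y assume "0 < lam \<and> lam \<le> L \<and> solution lam U" and y: "y \<in> V"
    then have lam: "0 < lam" "lam \<le> L" and sol: "solution lam U" by auto
    have "- C \<le> lap (U i) x" if x: "x \<in> V" for x
    proof -
      have "\<phi> i (U (\<not> i) x) * \<gamma> i (U i x) \<le> \<phi> i 0 * c i"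
        by (intro mult_mono \<phi>_le \<gamma>_bound \<gamma>_nonneg less_imp_le[OF \<phi>_pos]
            less_imp_le[OF solution_neg[OF sol lam(1) x]])
      then have "lam * (\<phi> i (U (\<not> i) x) * \<gamma> i (U i x)) \<le> C"
        unfolding C_def
        by (intro mult_mono[OF lam(2)] mult_nonneg_nonneg \<gamma>_nonneg less_imp_le[OF \<phi>_pos]
            less_imp_le[OF L] less_imp_le[OF solution_neg[OF sol lam(1) x]])
      then show ?thesis using solution_lap[OF sol x, of i] f_nonneg[OF x, of i]
        by (simp add: rhs_def mult.assoc)
    qed
    then have osc: "U i x - U i y \<le> B" if "x \<in> V" for x using B[of "U i"] that y by blast
    have "\<exists>x\<in>V. K < U i x"
    proof (rule ccontr)
      assume "\<not> (\<exists>x\<in>V. K < U i x)"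
      then have "\<phi> j (U (\<not> j) x) \<le> e" if "x \<in> V" for x
        using that K[of "U i x"] by (auto simp: j_def not_less less_imp_le)
      then have "M \<le> lam * (e * c j * graph_volume \<Gamma> \<mu>)"
        unfolding M_def by (rule source_mass_le[OF sol lam(1)])
      also have "\<dots> \<le> L * (e * c j * graph_volume \<Gamma> \<mu>)"
        using lam e c_pos[of j] volume_pos by (intro mult_right_mono) auto
      also have "\<dots> = M / 2" using L c_pos[of j] volume_pos by (simp add: e_def)
      finally show False using M by simp
    qed
    then obtain x where "x \<in> V" "K < U i x" by blast
    then show "K - B \<le> U i y" using osc[of x] by simp
  qed
qed auto

lemma solution_limit:
  assumes sol: "\<And>n. solution (lam n) (U n)" and lam: "lam \<longlonglongrightarrow> l"
    and U: "\<And>i x. x \<in> V \<Longrightarrow> (\<lambda>n. U n i x) \<longlonglongrightarrow> W i x"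
  shows "solution l W"
  unfolding solution_def
proof (intro allI ballI)
  fix i x assume x: "x \<in> V"
  have "(\<lambda>n. lap (U n i) x) \<longlonglongrightarrow> lap (W i) x" using U x by (intro tendsto_lap)
  moreover have "(\<lambda>n. rhs (lam n) (U n) i x) \<longlonglongrightarrow> rhs l W i x"
    unfolding rhs_def
    by (intro tendsto_intros lam isCont_tendsto_compose[OF \<phi>_cont] isCont_tendsto_compose[OF \<gamma>_cont] U x)
  moreover have "lap (U n i) x = rhs (lam n) (U n) i x" for n
    by (rule solution_lap[OF sol x])
  ultimately show "lap (W i) x = rhs l W i x" by (simp add: LIMSEQ_unique)
qed

text \<open>The parameters that admit a solution form an up-set, so the critical one is their infimum. It
  is attained: as \<open>\<lambda>\<close> decreases to it, the maximal solutions decrease and stay bounded.\<close>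

theorem critical_parameter:
  obtains lc where "0 < lc"
    and "\<And>i. (\<Sum>x\<in>V. \<mu> x * f i x) \<le> lc * (\<phi> i 0 * c i * graph_volume \<Gamma> \<mu>)"
    and "\<And>lam. lc < lam \<Longrightarrow> \<exists>U. maximal lam U"
    and "\<And>lam U. 0 < lam \<Longrightarrow> lam < lc \<Longrightarrow> \<not> solution lam U"
    and "\<exists>U. solution lc U"
proof -
  define P where "P = {lam. 0 < lam \<and> (\<exists>U. solution lam U)}"
  obtain l0 where "l0 > 0" "subsolution l0 (\<lambda>_ _. - 1)" using subsolution_for_large_parameter by blast
  then have "l0 \<in> P" unfolding P_def by (blast elim: maximal_if_subsolution dest: maximal_def[THEN iffD1])
  then have ne: "P \<noteq> {}" by auto
  have bdd: "bdd_below P" by (rule bdd_belowI[of _ 0]) (auto simp: P_def)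
  define lc where "lc = Inf P"
  have D: "0 < \<phi> i 0 * c i * graph_volume \<Gamma> \<mu>" for i
    using \<phi>_pos c_pos volume_pos by simp
  have bound: "(\<Sum>x\<in>V. \<mu> x * f i x) / (\<phi> i 0 * c i * graph_volume \<Gamma> \<mu>) \<le> lc" for i
    unfolding lc_def using ne D[of i]
    by (intro cInf_greatest) (auto simp: P_def pos_divide_le_eq intro: source_mass_le_parameter)
  have "0 < (\<Sum>x\<in>V. \<mu> x * f True x) / (\<phi> True 0 * c True * graph_volume \<Gamma> \<mu>)"
    using D measure_f_pos by simp
  also have "\<dots> \<le> lc" by (rule bound)
  finally have pos: "0 < lc" .
  have above: "\<exists>U. maximal lam U" if less: "lc < lam" for lam
  proof -
    obtain l where l: "l \<in> P" "l < lam"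
      using less cInf_less_iff[OF ne bdd, of lam] by (auto simp: lc_def)
    then obtain W where "solution l W" "0 < l" by (auto simp: P_def)
    then have "subsolution lam W" "0 < lam" using l by (auto intro: solution_imp_subsolution_larger)
    then show ?thesis by (auto elim: maximal_if_subsolution)
  qed
  have below: "\<not> solution lam U" if "0 < lam" "lam < lc" for lam U
    using cInf_lower[OF _ bdd, of lam] that by (auto simp: P_def lc_def)
  have attained: "\<exists>U. solution lc U"
  proof -
    define lam where "lam n = lc + inverse (real (Suc n))" for n
    have lam_gt: "lc < lam n" for n by (simp add: lam_def)
    have lam_le: "lam n \<le> lc + 1" for n by (simp add: lam_def field_simps)
    have lam_dec: "lam n < lam m" if "m < n" for m n
      using that by (simp add: lam_def field_simps)
    have "\<forall>n. \<exists>U. maximal (lam n) U" using above lam_gt by blast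
    then obtain U where U: "\<And>n. maximal (lam n) (U n)" by metis
    then have sol: "solution (lam n) (U n)" for n by (simp add: maximal_def)
    have lam_pos: "0 < lam n" for n using lam_gt[of n] pos by simp
    have "convergent (\<lambda>n. U n i x)" if x: "x \<in> V" for i x
    proof -
      obtain b where b: "\<And>lam U. 0 < lam \<Longrightarrow> lam \<le> lc + 1 \<Longrightarrow> solution lam U \<Longrightarrow> b \<le> U i x"
        using solutions_bounded_below[of "lc + 1" i] x by blast
      have "decseq (\<lambda>n. U n i x)"
      proof (rule decseq_SucI)
        show "U (Suc n) i x \<le> U n i x" for n
          using maximal_strict_mono[OF U sol lam_pos lam_dec x, of n "Suc n" i] by simp
      qed
      moreover have "\<forall>n. b \<le> U n i x" by (intro allI b[OF lam_pos lam_le sol])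
      ultimately obtain L where "(\<lambda>n. U n i x) \<longlonglongrightarrow> L" by (rule decseq_convergent)
      then show ?thesis by (auto simp: convergent_def)
    qed
    then have "(\<lambda>n. U n i x) \<longlonglongrightarrow> lim (\<lambda>n. U n i x)" if "x \<in> V" for i x
      using that by (simp add: convergent_LIMSEQ_iff)
    moreover have "lam \<longlonglongrightarrow> lc"
      unfolding lam_def using tendsto_add[OF tendsto_const LIMSEQ_inverse_real_of_nat, of lc] by simp
    ultimately have "solution lc (\<lambda>i x. lim (\<lambda>n. U n i x))"
      by (intro solution_limit[OF sol])
    then show ?thesis by blast
  qed
  show thesis
    by (rule that[OF pos _ above below attained]) (use bound D in \<open>simp_all add: pos_divide_le_eq\<close>)
qed

end

section \<open>The nonlinearities and the Dirac sources\<close>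

text \<open>By the fundamental theorem of calculus, \<open>s \<mapsto> g(s\<^sup>2)\<close> has derivative \<open>- 2 s G(s\<^sup>2)\<close>. Hence \<open>g\<close> is
  continuous and strictly decreasing on the positive reals, and it vanishes at \<open>1\<close>. Since \<open>G \<le> G 1\<close>
  on \<open>[0, 1]\<close>, the function \<open>s \<mapsto> g(s\<^sup>2) + G(1) s\<^sup>2\<close> is nondecreasing there, which gives
  \<open>g \<le> G 1\<close>.\<close>

context
  fixes G g :: "real \<Rightarrow> real"
  assumes G_cont: "continuous_on {0..} G"
    and G_mono: "mono_on {0..} G"
    and G_pos: "\<And>s. s \<ge> 0 \<Longrightarrow> G s > 0"
    and g_def: "\<And>s. s \<ge> 0 \<Longrightarrow> g (s\<^sup>2) = (LBINT t=ereal s..ereal 1. 2 * t * G (t\<^sup>2))"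
begin

lemma primitive_derivative:
  assumes s: "0 < s"
  shows "((\<lambda>s. g (s\<^sup>2)) has_real_derivative - (2 * s * G (s\<^sup>2))) (at s)"
proof -
  define b where "b = max 1 s + 1"
  have "continuous_on {0..b} (\<lambda>t. G (t\<^sup>2))"
    by (rule continuous_on_compose2[OF G_cont]) (auto intro!: continuous_intros)
  then have cont: "continuous_on {0..b} (\<lambda>t. 2 * t * G (t\<^sup>2))"
    by (intro continuous_intros)
  have "((\<lambda>u. LBINT t=1..u. 2 * t * G (t\<^sup>2)) has_vector_derivative 2 * s * G (s\<^sup>2)) (at s within {0..b})"
    using s interval_integral_FTC2[OF _ _ cont, of 1 s] by (simp add: b_def one_ereal_def)
  then have "((\<lambda>u. LBINT t=1..u. 2 * t * G (t\<^sup>2)) has_real_derivative 2 * s * G (s\<^sup>2)) (at s)"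
    using s by (subst (asm) at_within_interior)
      (auto simp: b_def has_real_derivative_iff_has_vector_derivative)
  then have "((\<lambda>u. - (LBINT t=1..u. 2 * t * G (t\<^sup>2))) has_real_derivative - (2 * s * G (s\<^sup>2))) (at s)"
    by (rule DERIV_minus)
  then show ?thesis
  proof (rule has_field_derivative_transform_within_open[where S = "{0<..}"])
    show "- (LBINT t=1..u. 2 * t * G (t\<^sup>2)) = g (u\<^sup>2)" if "u \<in> {0<..}" for u
      using that g_def[of u]
      by (subst interval_integral_endpoints_reverse) (simp add: one_ereal_def)
  qed (use s in auto)
qed

lemma g_exp_eq: "g (exp t) = g ((exp (t / 2))\<^sup>2)" for t
  by (simp add: power2_eq_square flip: exp_add)

lemma isCont_g_exp: "isCont (\<lambda>t. g (exp t)) t"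
  unfolding g_exp_eq
  by (rule isCont_o2[OF _ DERIV_isCont[OF primitive_derivative]]) (auto intro!: continuous_intros)

lemma g_exp_strict_antimono:
  assumes "s < t"
  shows "g (exp t) < g (exp s)"
  unfolding g_exp_eq
proof (rule DERIV_neg_imp_decreasing[of "exp (s / 2)" "exp (t / 2)" "\<lambda>s. g (s\<^sup>2)"])
  fix x assume "exp (s / 2) \<le> x"
  then have x: "0 < x" using less_le_trans[OF exp_gt_zero] by blast
  then show "\<exists>y. ((\<lambda>s. g (s\<^sup>2)) has_real_derivative y) (at x) \<and> y < 0"
    using primitive_derivative[OF x] G_pos[of "x\<^sup>2"] by (intro exI[of _ "- (2 * x * G (x\<^sup>2))"]) simp
qed (use assms in simp)

lemma g_one: "g 1 = 0"
  using g_def[of 1] by simp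

lemma g_exp_le: "g (exp t) \<le> G 1"
proof (cases "t < 0")
  case True
  let ?k = "\<lambda>s. g (s\<^sup>2) + G 1 * s\<^sup>2"
  have "?k (exp (t / 2)) \<le> ?k 1"
  proof (rule DERIV_nonneg_imp_nondecreasing[where f = ?k])
    show "exp (t / 2) \<le> 1" using True by simp
    fix x assume x: "exp (t / 2) \<le> x" "x \<le> 1"
    then have x0: "0 < x" using less_le_trans[OF exp_gt_zero] by blast
    have "G (x\<^sup>2) \<le> G 1"
      using x x0 by (intro mono_onD[OF G_mono]) (auto simp: power_le_one)
    then have "0 \<le> - (2 * x * G (x\<^sup>2)) + G 1 * (2 * x)" using x0 by simp
    moreover have "(?k has_real_derivative - (2 * x * G (x\<^sup>2)) + G 1 * (2 * x)) (at x)"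
      using primitive_derivative[OF x0] by (auto intro!: derivative_eq_intros)
    ultimately show "\<exists>y. (?k has_real_derivative y) (at x) \<and> 0 \<le> y" by blast
  qed
  moreover have "0 \<le> G 1 * (exp (t / 2))\<^sup>2" using G_pos[of 1] by simp
  ultimately show ?thesis unfolding g_exp_eq by (simp add: g_one)
next
  case False
  then have "g (exp t) \<le> g (exp 0)"
    using g_exp_strict_antimono[of 0 t] by (cases "t = 0") auto
  then show ?thesis using g_one G_pos[of 1] by simp
qed

lemma isCont_exp_mult_G_exp: "isCont (\<lambda>t. exp t * G (exp t)) t"
proof -
  have "continuous_on UNIV (\<lambda>t. exp t * G (exp t))"
    by (intro continuous_intros continuous_on_compose2[OF G_cont]) auto
  then show ?thesis by (simp add: continuous_on_eq_continuous_at)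
qed

lemma exp_mult_G_exp_strict_mono: "s < t \<Longrightarrow> exp s * G (exp s) < exp t * G (exp t)"
  using G_pos by (intro mult_less_le_imp_less mono_onD[OF G_mono]) auto

lemma exp_mult_G_exp_at_bot: "((\<lambda>t. exp t * G (exp t)) \<longlongrightarrow> 0) at_bot"
proof (rule tendsto_sandwich[where f = "\<lambda>_. 0" and h = "\<lambda>t. exp t * G 1"])
  show "((\<lambda>t::real. exp t * G 1) \<longlongrightarrow> 0) at_bot"
    using tendsto_mult[OF exp_at_bot tendsto_const] by simp
  have "exp t * G (exp t) \<le> exp t * G 1" if "t \<le> 0" for t
    using that by (intro mult_left_mono mono_onD[OF G_mono]) auto
  then show "eventually (\<lambda>t. exp t * G (exp t) \<le> exp t * G 1) at_bot"
    by (rule eventually_mono[OF eventually_le_at_bot])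
  show "eventually (\<lambda>t. 0 \<le> exp t * G (exp t)) at_bot"
    using G_pos by (simp add: less_imp_le)
qed simp

end

lemma C_infinity_on_imp_continuous_on: "C_infinity_on S f \<Longrightarrow> continuous_on S f"
proof -
  assume "C_infinity_on S f"
  then obtain D :: "nat \<Rightarrow> real \<Rightarrow> real" where D: "\<forall>x\<in>S. D 0 x = f x"
      "\<forall>n. \<forall>x\<in>S. (D n has_real_derivative D (Suc n) x) (at x within S)"
    unfolding C_infinity_on_def by blast
  then have "continuous_on S (D 0)" by (intro DERIV_continuous_on) auto
  then show ?thesis using D(1) by (simp cong: continuous_on_cong)
qed

lemma integral_sum_dirac:
  assumes "finite W" "\<And>j. j \<in> J \<Longrightarrow> p j \<in> W" "\<And>x. x \<in> W \<Longrightarrow> \<mu> x > 0"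
  shows "(\<Sum>x\<in>W. \<mu> x * (\<Sum>j\<in>J. dirac \<mu> (p j) x)) = real (card J)"
proof -
  have "(\<Sum>x\<in>W. \<mu> x * (\<Sum>j\<in>J. dirac \<mu> (p j) x)) = (\<Sum>j\<in>J. \<Sum>x\<in>W. \<mu> x * dirac \<mu> (p j) x)"
    by (simp add: sum_distrib_left) (rule sum.swap)
  also have "\<dots> = (\<Sum>j\<in>J. 1)"
  proof (rule sum.cong[OF refl])
    fix j assume j: "j \<in> J"
    have "(\<Sum>x\<in>W. \<mu> x * dirac \<mu> (p j) x) = (\<Sum>x\<in>W. if x = p j then 1 else 0)"
      using assms(3)[OF assms(2)[OF j]] by (intro sum.cong refl) (auto simp: dirac_def)
    then show "(\<Sum>x\<in>W. \<mu> x * dirac \<mu> (p j) x) = 1" using assms(1,2) j by simp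
  qed
  finally show ?thesis by simp
qed

section \<open>Existence, nonexistence and monotonicity across the critical parameter\<close>

theorem theorem1p1:
  fixes \<Gamma> :: "'a pair_pre_digraph"
    and \<omega> :: "'a \<Rightarrow> 'a \<Rightarrow> real" and \<mu> :: "'a \<Rightarrow> real"
    and G H g h :: "real \<Rightarrow> real"
    and N1 N2 :: nat and p' p'' :: "nat \<Rightarrow> 'a"
    and S :: "real \<Rightarrow> ('a \<Rightarrow> real) \<Rightarrow> ('a \<Rightarrow> real) \<Rightarrow> bool"
  assumes graph: "pair_graph \<Gamma>"
    and conn: "Digraph_Component.connected (with_proj \<Gamma>)"
    and weight_pos: "\<And>x y. (x, y) \<in> parcs \<Gamma> \<Longrightarrow> \<omega> x y > 0"
    and weight_sym: "\<And>x y. (x, y) \<in> parcs \<Gamma> \<Longrightarrow> \<omega> x y = \<omega> y x"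
    and measure_pos: "\<And>x. x \<in> pverts \<Gamma> \<Longrightarrow> \<mu> x > 0"
    and G_smooth: "C_infinity_on {0..} G" and H_smooth: "C_infinity_on {0..} H"
    and G_mono: "mono_on {0..} G" and H_mono: "mono_on {0..} H"
    and G_pos: "\<And>s. s \<ge> 0 \<Longrightarrow> G s > 0" and H_pos: "\<And>s. s \<ge> 0 \<Longrightarrow> H s > 0"
    and g_def: "\<And>s. s \<ge> 0 \<Longrightarrow> g (s\<^sup>2) = (LBINT t=ereal s..ereal 1. 2 * t * G (t\<^sup>2))"
    and h_def: "\<And>s. s \<ge> 0 \<Longrightarrow> h (s\<^sup>2) = (LBINT t=ereal s..ereal 1. 2 * t * H (t\<^sup>2))"
    and N1_pos: "N1 > 0" and N2_pos: "N2 > 0"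
    and p'_vertex: "\<And>j. j \<in> {1..N1} \<Longrightarrow> p' j \<in> pverts \<Gamma>"
    and p''_vertex: "\<And>j. j \<in> {1..N2} \<Longrightarrow> p'' j \<in> pverts \<Gamma>"
    and S_eq: "S = is_solution \<Gamma> \<omega> \<mu> G H g h N1 p' N2 p''"
  shows "\<exists>lam\<^sub>c \<ge> 4 * pi * real (max N1 N2) / (G 1 * H 1 * graph_volume \<Gamma> \<mu>).
    (\<forall>lam > lam\<^sub>c. \<exists>!(u, v). is_maximal_solution (pverts \<Gamma>) (S lam) u v) \<and>
    (\<forall>lam\<^sub>1 lam\<^sub>2 u\<^sub>1 v\<^sub>1 u\<^sub>2 v\<^sub>2. lam\<^sub>1 > lam\<^sub>2 \<and> lam\<^sub>2 > lam\<^sub>c \<and>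
       is_maximal_solution (pverts \<Gamma>) (S lam\<^sub>1) u\<^sub>1 v\<^sub>1 \<and>
       is_maximal_solution (pverts \<Gamma>) (S lam\<^sub>2) u\<^sub>2 v\<^sub>2 \<longrightarrow>
       (\<forall>x\<in>pverts \<Gamma>. u\<^sub>1 x > u\<^sub>2 x \<and> v\<^sub>1 x > v\<^sub>2 x)) \<and>
    (\<forall>lam. 0 < lam \<and> lam < lam\<^sub>c \<longrightarrow> \<not> (\<exists>u v. S lam u v)) \<and>
    (\<exists>u v. S lam\<^sub>c u v \<and>
       (\<forall>lam > lam\<^sub>c. \<forall>u' v'. is_maximal_solution (pverts \<Gamma>) (S lam) u' v' \<longrightarrow>
         (\<forall>x\<in>pverts \<Gamma>. u x < u' x \<and> v x < v' x)))"
proof -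
  interpret weighted_graph \<Gamma> \<omega> \<mu>
    using graph conn weight_pos weight_sym measure_pos by (rule weighted_graph.intro)
  note G_cont = C_infinity_on_imp_continuous_on[OF G_smooth]
  note H_cont = C_infinity_on_imp_continuous_on[OF H_smooth]
  note G_facts = G_cont G_mono G_pos g_def and H_facts = H_cont H_mono H_pos h_def
  define \<phi> where "\<phi> = (\<lambda>i t. if i then exp t * H (exp t) else exp t * G (exp t))"
  define \<gamma> where "\<gamma> = (\<lambda>i t. if i then g (exp t) else h (exp t))"
  define f where "f = (\<lambda>i x. 4 * pi * (if i then \<Sum>j=1..N1. dirac \<mu> (p' j) x else \<Sum>j=1..N2. dirac \<mu> (p'' j) x))"
  define c where "c = (\<lambda>i. if i then G 1 else H 1)"
  have mass: "(\<Sum>x\<in>V. \<mu> x * f i x) = 4 * pi * real (if i then N1 else N2)" for i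
  proof -
    have "(\<Sum>x\<in>V. \<mu> x * (4 * pi * k x)) = 4 * pi * (\<Sum>x\<in>V. \<mu> x * k x)" for k
      by (simp add: sum_distrib_left mult.left_commute)
    then show ?thesis
      using integral_sum_dirac[of V "{1..N1}" p' \<mu>, OF finite_V p'_vertex measure_pos]
        integral_sum_dirac[of V "{1..N2}" p'' \<mu>, OF finite_V p''_vertex measure_pos]
      by (simp add: f_def)
  qed
  have f_nonneg: "0 \<le> f i x" if "x \<in> V" for i x
    using measure_pos[OF that] by (auto simp: f_def dirac_def intro!: sum_nonneg mult_nonneg_nonneg)
  have f_pos: "\<exists>x\<in>V. f i x > 0" for i
  proof (rule ccontr)
    assume "\<not> (\<exists>x\<in>V. f i x > 0)"
    then have "(\<Sum>x\<in>V. \<mu> x * f i x) \<le> 0"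
      using measure_pos by (intro sum_nonpos) (auto simp: not_less mult_le_0_iff less_imp_le)
    moreover have "0 < 4 * pi * real (if i then N1 else N2)"
      using N1_pos N2_pos by (intro mult_pos_pos) auto
    ultimately show False using mass[of i] by linarith
  qed
  interpret cooperative_system \<Gamma> \<omega> \<mu> \<phi> \<gamma> f c
  proof unfold_locales
    fix i :: bool and s t :: real and x
    show "isCont (\<phi> i) t"
      using isCont_exp_mult_G_exp[OF G_facts] isCont_exp_mult_G_exp[OF H_facts]
      by (cases i) (simp_all add: \<phi>_def)
    show "\<phi> i s < \<phi> i t" if "s < t"
      using exp_mult_G_exp_strict_mono[OF G_facts that] exp_mult_G_exp_strict_mono[OF H_facts that]
      by (simp add: \<phi>_def)
    show "0 < \<phi> i t" using G_pos H_pos by (simp add: \<phi>_def)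
    show "(\<phi> i \<longlongrightarrow> 0) at_bot"
      using exp_mult_G_exp_at_bot[OF G_facts] exp_mult_G_exp_at_bot[OF H_facts]
      by (cases i) (simp_all add: \<phi>_def)
    show "isCont (\<gamma> i) t"
      using isCont_g_exp[OF G_facts] isCont_g_exp[OF H_facts] by (cases i) (simp_all add: \<gamma>_def)
    show "\<gamma> i t < \<gamma> i s" if "s < t"
      using g_exp_strict_antimono[OF G_facts that] g_exp_strict_antimono[OF H_facts that]
      by (simp add: \<gamma>_def)
    show "\<gamma> i 0 = 0" using g_one[OF G_facts] g_one[OF H_facts] by (simp add: \<gamma>_def)
    show "\<gamma> i t \<le> c i" using g_exp_le[OF G_facts] g_exp_le[OF H_facts] by (simp add: \<gamma>_def c_def)
    show "0 \<le> f i x" if "x \<in> V" by (rule f_nonneg[OF that])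
    show "\<exists>x\<in>V. 0 < f i x" by (rule f_pos)
  qed
  define pair :: "('a \<Rightarrow> real) \<Rightarrow> ('a \<Rightarrow> real) \<Rightarrow> bool \<Rightarrow> 'a \<Rightarrow> real"
    where "pair u v = (\<lambda>i. if i then u else v)" for u v
  have S_iff: "S lam u v \<longleftrightarrow> u \<in> extensional V \<and> v \<in> extensional V \<and> solution lam (pair u v)"
    for lam u v
    unfolding S_eq is_solution_def solution_def rhs_def all_bool_eq
    unfolding pair_def \<phi>_def \<gamma>_def f_def
    by (auto simp: mult.assoc)
  have rhs_cong: "rhs lam U i x = rhs lam W i x" if "\<And>j. U j x = W j x" for lam U W i x
    using that by (simp add: rhs_def)
  have lap_restrict: "lap (restrict u V) x = lap u x" if "x \<in> V" for u x
    unfolding graph_laplacian_def using that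
    by (intro arg_cong2[where f = "(*)"] sum.cong refl) (auto dest: arc_ends)
  \<comment> \<open>Changes outside the vertex set do not affect the equations, so any family solving them has an
    extensional representative.\<close>
  have S_restrict: "S lam (restrict (U True) V) (restrict (U False) V)" if "solution lam U" for lam U
  proof -
    have "pair (restrict (U True) V) (restrict (U False) V) = (\<lambda>i. restrict (U i) V)"
      by (auto simp: pair_def fun_eq_iff)
    moreover have "solution lam (\<lambda>i. restrict (U i) V)"
      unfolding solution_def
    proof (intro allI ballI)
      fix i x assume x: "x \<in> V"
      then show "lap (restrict (U i) V) x = rhs lam (\<lambda>i. restrict (U i) V) i x"
        using solution_lap[OF that x, of i] rhs_cong[of U x "\<lambda>i. restrict (U i) V"]
        by (simp add: lap_restrict)
    qed
    ultimately show ?thesis by (simp add: S_iff)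
  qed
  have S_sol: "solution lam (pair u v)" if "S lam u v" for lam u v using that by (simp add: S_iff)
  obtain lc where lc: "0 < lc"
      "\<And>i. (\<Sum>x\<in>V. \<mu> x * f i x) \<le> lc * (\<phi> i 0 * c i * graph_volume \<Gamma> \<mu>)"
      "\<And>lam. lc < lam \<Longrightarrow> \<exists>U. maximal lam U"
      "\<And>lam U. 0 < lam \<Longrightarrow> lam < lc \<Longrightarrow> \<not> solution lam U"
      "\<exists>U. solution lc U"
    using critical_parameter by blast
  have max_iff: "maximal lam (pair u v)" if max: "is_maximal_solution V (S lam) u v" for lam u v
    unfolding maximal_def
  proof (intro conjI allI impI ballI)
    show "solution lam (pair u v)" using max by (auto simp: is_maximal_solution_def intro: S_sol)
    fix W i x assume sol: "solution lam W" and x: "x \<in> V"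
    have "S lam (restrict (W True) V) (restrict (W False) V)" by (rule S_restrict[OF sol])
    then have "(restrict (W True) V, restrict (W False) V) = (u, v) \<or>
        restrict (W True) V x < u x \<and> restrict (W False) V x < v x"
      using max x unfolding is_maximal_solution_def by blast
    then show "W i x \<le> pair u v i x" using x by (cases i) (auto simp: pair_def)
  qed
  have exists: "\<exists>u v. is_maximal_solution V (S lam) u v" if lam: "lc < lam" for lam
  proof -
    obtain U where U: "maximal lam U" using lc(3)[OF lam] by blast
    have lam0: "0 < lam" using lam lc(1) by simp
    define u v where "u = restrict (U True) V" and "v = restrict (U False) V"
    have "S lam u v" unfolding u_def v_def using U by (intro S_restrict) (simp add: maximal_def)
    moreover have "u' x < u x \<and> v' x < v x"
      if S': "S lam u' v'" and ne: "(u', v') \<noteq> (u, v)" and x: "x \<in> V" for u' v' x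
    proof -
      have "\<exists>j. \<exists>z\<in>V. pair u' v' j z \<noteq> U j z"
      proof (rule ccontr)
        assume "\<not> (\<exists>j. \<exists>z\<in>V. pair u' v' j z \<noteq> U j z)"
        then have eq: "pair u' v' j z = U j z" if "z \<in> V" for j z using that by blast
        have "u' = u" "v' = v"
          using S' eq[of _ True] eq[of _ False]
          by (auto simp: S_iff u_def v_def pair_def fun_eq_iff extensional_def restrict_def)
        then show False using ne by simp
      qed
      then have "pair u' v' i x < U i x" for i
        using maximal_strict[OF U S_sol[OF S'] lam0 _ _ x] by blast
      from this[of True] this[of False] show ?thesis using x by (simp add: pair_def u_def v_def)
    qed
    ultimately show ?thesis unfolding is_maximal_solution_def by blast
  qed
  have unique: "u = u' \<and> v = v'"
    if "is_maximal_solution V (S lam) u v" "is_maximal_solution V (S lam) u' v'" for lam u v u' v'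
  proof (rule ccontr)
    assume ne: "\<not> (u = u' \<and> v = v')"
    obtain x where x: "x \<in> V" using V_nonempty by blast
    have "u x < u' x" "u' x < u x"
      using that ne x unfolding is_maximal_solution_def by (metis prod.inject)+
    then show False by simp
  qed
  have strict: "u x < u' x \<and> v x < v' x"
    if "S lam u v" "is_maximal_solution V (S lam') u' v'" "0 < lam" "lam < lam'" "x \<in> V"
    for lam lam' u v u' v' x
    using maximal_strict_mono[OF max_iff[OF that(2)] S_sol[OF that(1)] that(3-5), of True]
      maximal_strict_mono[OF max_iff[OF that(2)] S_sol[OF that(1)] that(3-5), of False]
    by (simp add: pair_def)
  have bound: "4 * pi * real (max N1 N2) / (G 1 * H 1 * graph_volume \<Gamma> \<mu>) \<le> lc"
  proof -
    have D: "0 < G 1 * H 1 * graph_volume \<Gamma> \<mu>" using G_pos H_pos volume_pos by simp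
    have "4 * pi * real N1 \<le> lc * (G 1 * H 1 * graph_volume \<Gamma> \<mu>)"
      "4 * pi * real N2 \<le> lc * (G 1 * H 1 * graph_volume \<Gamma> \<mu>)"
      using lc(2)[of True] lc(2)[of False] unfolding mass
      by (simp_all add: \<phi>_def c_def mult.commute mult.left_commute)
    then have "4 * pi * real (max N1 N2) \<le> lc * (G 1 * H 1 * graph_volume \<Gamma> \<mu>)"
      by (simp add: max_def)
    then show ?thesis using D by (simp add: pos_divide_le_eq)
  qed
  show ?thesis
  proof (intro exI[of _ lc] conjI bound)
    show "\<forall>lam>lc. \<exists>!(u, v). is_maximal_solution V (S lam) u v"
    proof (intro allI impI)
      fix lam assume "lc < lam"
      then obtain u v where uv: "is_maximal_solution V (S lam) u v" using exists by blast
      show "\<exists>!(u, v). is_maximal_solution V (S lam) u v"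
        by (rule ex1I[of _ "(u, v)"]) (use uv unique in auto)
    qed
    show "\<forall>lam\<^sub>1 lam\<^sub>2 u\<^sub>1 v\<^sub>1 u\<^sub>2 v\<^sub>2. lam\<^sub>1 > lam\<^sub>2 \<and> lam\<^sub>2 > lc \<and>
       is_maximal_solution V (S lam\<^sub>1) u\<^sub>1 v\<^sub>1 \<and> is_maximal_solution V (S lam\<^sub>2) u\<^sub>2 v\<^sub>2 \<longrightarrow>
       (\<forall>x\<in>V. u\<^sub>1 x > u\<^sub>2 x \<and> v\<^sub>1 x > v\<^sub>2 x)"
    proof (intro allI impI ballI)
      fix l1 l2 u1 v1 u2 v2 x
      assume "l1 > l2 \<and> l2 > lc \<and> is_maximal_solution V (S l1) u1 v1 \<and>
        is_maximal_solution V (S l2) u2 v2" and x: "x \<in> V"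
      then have "l2 < l1" "0 < l2" "S l2 u2 v2" "is_maximal_solution V (S l1) u1 v1"
        using lc(1) by (auto simp: is_maximal_solution_def)
      then show "u1 x > u2 x \<and> v1 x > v2 x" using strict x by blast
    qed
    show "\<forall>lam. 0 < lam \<and> lam < lc \<longrightarrow> \<not> (\<exists>u v. S lam u v)"
      using lc(4) S_sol by blast
    show "\<exists>u v. S lc u v \<and> (\<forall>lam>lc. \<forall>u' v'. is_maximal_solution V (S lam) u' v' \<longrightarrow>
         (\<forall>x\<in>V. u x < u' x \<and> v x < v' x))"
    proof -
      obtain U where "solution lc U" using lc(5) by blast
      then have "S lc (restrict (U True) V) (restrict (U False) V)" by (rule S_restrict)
      then show ?thesis using strict lc(1) by blast
    qed
  qed
qed

end
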